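(* Let $P=\mathbb{C}[x_{ijk} : i,j\in\{1,2\},\ k\in\{1,2,3\}]$ be the polynomial algebra in the 12 entries of a general $2\times 2\times 3$ array, with $G=SL_2(\mathbb{C})\times SL_2(\mathbb{C})\times SL_3(\mathbb{C})$ acting on $P$ by changes of basis along the three directions. Define $$ \begin{aligned} \mathcal{D} ={}& \tfrac12\,\mathrm{orbit}\big(x_{111}^2\,x_{122}\,x_{212}\,x_{223}^2\big) - \mathrm{orbit}\big(x_{111}^2\,x_{122}\,x_{222}\,x_{213}\,x_{223}\big)\\ &+ \tfrac12\,\mathrm{orbit}\big(x_{111}\,x_{121}\,x_{112}\,x_{222}\,x_{213}\,x_{223}\big) + \tfrac12\,\mathrm{orbit}\big(x_{111}\,x_{211}\,x_{112}\,x_{222}\,x_{123}\,x_{223}\big)\\ &- \tfrac12\,\mathrm{orbit}\big(x_{111}\,x_{221}\,x_{112}\,x_{222}\,x_{123}\,x_{213}\big), \end{aligned} $$ where $\mathrm{orbit}(M)$ denotes the signed orbit of the monomial $M$ under $S_2\times S_2\times S_3$. Then $\mathcal{D}$ is the simplest non-constant $G$-invariant polynomial in $P$, in the following sense: there is no nonzero homogeneous $G$-invariant polynomial in $P$ of degree $n$ for $1\le n\le 5$; the polynomial $\mathcal{D}$ is nonzero, homogeneous of degree $6$ and $G$-invariant; and every homogeneous $G$-invariant polynomial of degree $6$ in $P$ is a scalar multiple of $\mathcal{D}$. Moreover, $\mathcal{D}$ has exactly 66 terms (monomials with nonzero coefficient), and each of its nonzero coefficients is one of $\pm1,\pm2$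.
   Context: Action of $G$: the indeterminates $x_{ijk}$ ($i,j\in\{1,2\}$, $k\in\{1,2,3\}$) are identified with the basis $x_i\otimes x_j\otimes x_k$ of $\mathbb{C}^2\otimes\mathbb{C}^2\otimes\mathbb{C}^3$ formed from the standard bases. An element $(A,B,C)\in G=SL_2(\mathbb{C})\times SL_2(\mathbb{C})\times SL_3(\mathbb{C})$ acts by $$(A,B,C)\cdot x_{ijk}=\sum_{p=1}^{2}\sum_{q=1}^{2}\sum_{r=1}^{3}A_{pi}\,B_{qj}\,C_{rk}\,x_{pqr},$$ extended to $P$ as a $\mathbb{C}$-algebra automorphism. A polynomial $f\in P$ is ($G$-)invariant if $(A,B,C)\cdot f=f$ for all $(A,B,C)\in G$. (Regarding the $x_{ijk}$ instead as coordinate functions on the space of arrays gives the same invariant polynomials.) Signed orbit: the group $S_2\times S_2\times S_3$ (where $S_n$ is the group of permutations of $\{1,\dots,n\}$) acts on monomials in $P$ by permuting subscripts: $(\mu,\nu,\pi)$ sends $x_{ijk}$ to $x_{\mu(i)\,\nu(j)\,\pi(k)}$, extended multiplicatively. For a monomial $M$ of degree 6, the signed orbit is the sum over all 24 group elements (with repetitions counted) $$\mathrm{orbit}(M)=\sum_{\mu\in S_2}\ \sum_{\nu\in S_2}\ \sum_{\pi\in S_3}\mathrm{sgn}(\mu)\,\mathrm{sgn}(\nu)\;(\mu,\nu,\pi)\cdot M ;$$ the sign of the $S_3$ component is ignored. *)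

theory Defs
  imports "HOL-Analysis.Analysis" "HOL-Library.Poly_Mapping" "HOL-Combinatorics.Permutations"
begin

text \<open>
  Polynomials over \<open>\<complex>\<close> in the indeterminates \<open>'v\<close> are finitely supported maps from exponent
  vectors to coefficients, with the convolution product of \<open>Poly_Mapping\<close>. A term (monomial with
  nonzero coefficient) of \<open>f\<close> is thus an element of \<open>keys f\<close>.
\<close>

type_synonym 'v mpoly = "('v \<Rightarrow>\<^sub>0 nat) \<Rightarrow>\<^sub>0 complex"

definition Const :: "complex \<Rightarrow> 'v mpoly" where
  "Const c = Poly_Mapping.single 0 c"

definition Var :: "'v \<Rightarrow> 'v mpoly" where
  "Var v = Poly_Mapping.single (Poly_Mapping.single v 1) 1"

definition alg_hom :: "('v \<Rightarrow> 'w mpoly) \<Rightarrow> 'v mpoly \<Rightarrow> 'w mpoly" where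
  \<comment> \<open>the \<open>\<complex>\<close>-algebra homomorphism sending each indeterminate \<open>v\<close> to \<open>\<sigma> v\<close>\<close>
  "alg_hom \<sigma> f =
     (\<Sum>m\<in>Poly_Mapping.keys f. Const (Poly_Mapping.lookup f m) *
        (\<Prod>v\<in>Poly_Mapping.keys m. \<sigma> v ^ Poly_Mapping.lookup m v))"

definition homogeneous :: "nat \<Rightarrow> 'v mpoly \<Rightarrow> bool" where
  \<comment> \<open>the zero polynomial is homogeneous of every degree\<close>
  "homogeneous n f \<longleftrightarrow>
     (\<forall>m\<in>Poly_Mapping.keys f. (\<Sum>v\<in>Poly_Mapping.keys m. Poly_Mapping.lookup m v) = n)"

text \<open>
  The index sets \<open>{1,2}\<close> and \<open>{1,2,3}\<close> are the numeral types \<open>2\<close> and \<open>3\<close>, the same types that index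
  the matrices. These types carry modular arithmetic, so the index \<open>2\<close> of type \<open>2\<close> (and \<open>3\<close> of
  type \<open>3\<close>) is also \<open>0\<close>; the numerals \<open>1, 2\<close> (and \<open>1, 2, 3\<close>) are pairwise distinct and exhaustive.
\<close>

type_synonym P = "(2 \<times> 2 \<times> 3) mpoly"

definition x :: "2 \<Rightarrow> 2 \<Rightarrow> 3 \<Rightarrow> P" where
  "x i j k = Var (i, j, k)"

definition SL :: "(complex ^ 'n ^ 'n) set" where
  "SL = {A. det A = 1}"

definition act :: "complex ^ 2 ^ 2 \<Rightarrow> complex ^ 2 ^ 2 \<Rightarrow> complex ^ 3 ^ 3 \<Rightarrow> P \<Rightarrow> P" where
  "act A B C = alg_hom (\<lambda>(i, j, k).
     \<Sum>p\<in>UNIV. \<Sum>q\<in>UNIV. \<Sum>r\<in>UNIV. Const (A $ p $ i * B $ q $ j * C $ r $ k) * x p q r)"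

definition invariant :: "P \<Rightarrow> bool" where
  "invariant f \<longleftrightarrow> (\<forall>A\<in>SL. \<forall>B\<in>SL. \<forall>C\<in>SL. act A B C f = f)"

definition perm_act :: "(2 \<Rightarrow> 2) \<Rightarrow> (2 \<Rightarrow> 2) \<Rightarrow> (3 \<Rightarrow> 3) \<Rightarrow> P \<Rightarrow> P" where
  "perm_act \<mu> \<nu> \<pi> = alg_hom (\<lambda>(i, j, k). x (\<mu> i) (\<nu> j) (\<pi> k))"

definition orbit :: "P \<Rightarrow> P" where
  "orbit M =
     (\<Sum>\<mu>\<in>{\<mu>. \<mu> permutes UNIV}. \<Sum>\<nu>\<in>{\<nu>. \<nu> permutes UNIV}. \<Sum>\<pi>\<in>{\<pi>. \<pi> permutes UNIV}.
        of_int (sign \<mu> * sign \<nu>) * perm_act \<mu> \<nu> \<pi> M)"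

definition \<D> :: P where
  "\<D> = Const (1/2) * orbit ((x 1 1 1)^2 * x 1 2 2 * x 2 1 2 * (x 2 2 3)^2)
     - orbit ((x 1 1 1)^2 * x 1 2 2 * x 2 2 2 * x 2 1 3 * x 2 2 3)
     + Const (1/2) * orbit (x 1 1 1 * x 1 2 1 * x 1 1 2 * x 2 2 2 * x 2 1 3 * x 2 2 3)
     + Const (1/2) * orbit (x 1 1 1 * x 2 1 1 * x 1 1 2 * x 2 2 2 * x 1 2 3 * x 2 2 3)
     - Const (1/2) * orbit (x 1 1 1 * x 2 2 1 * x 1 1 2 * x 2 2 2 * x 1 2 3 * x 2 1 3)"

end

theory Submission
  imports Defs "HOL-Computational_Algebra.Polynomial"
begin

text \<open>
  Read an array \<open>X\<close> as four vectors \<open>X\<^sub>i\<^sub>j \<in> \<complex>\<^sup>3\<close>. Four vectors in a space of dimension three satisfy a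
  linear relation, and Cramer's rule provides one whose coefficients are the signed
  \<open>3 \<times> 3\<close> minors: \<open>\<Sum> N\<^sub>i\<^sub>j X\<^sub>i\<^sub>j = 0\<close> with a \<open>2 \<times> 2\<close> matrix \<open>N = N(X)\<close> of cubic forms
  (\<open>kernel_form\<close>). The invariant \<open>\<D>\<close> is nothing but \<open>det N\<close> (\<open>eval_\<D>\<close>). A base change \<open>C\<close> in \<open>\<complex>\<^sup>3\<close>
  multiplies \<open>N\<close> by \<open>det C\<close>, and base changes \<open>A\<close>, \<open>B\<close> in the two copies of \<open>\<complex>\<^sup>2\<close> multiply it by \<open>det A\<close>
  times the adjugate of \<open>A\<close>, and similarly for \<open>B\<close>; so \<open>det N\<close> is multiplied by \<open>det A ^ 3\<close>, \<open>det B ^ 3\<close>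
  and \<open>det C ^ 2\<close>, and \<open>\<D>\<close> is invariant.

  For uniqueness, use \<open>N(X)\<close> itself as a base change in the first factor. The relation then says
  that the new array has \<open>X\<^sub>2\<^sub>2 = - X\<^sub>1\<^sub>1\<close>, i.e. that its three slices are traceless matrices, so it arises
  from one fixed array, whose slices are a basis of the traceless matrices, by a base change in
  \<open>\<complex>\<^sup>3\<close> (\<open>to_normal_array\<close>). An invariant of degree six also transforms by \<open>det A ^ 3\<close> and
  \<open>det C ^ 2\<close> under all invertible matrices, because a matrix can be rescaled to determinant one at the
  cost of a power of the scalar. Hence its value at every \<open>X\<close> with \<open>det N \<noteq> 0\<close> is \<open>det N\<close> times its value
  at the fixed array (\<open>eval_eq_normal_form\<close>), and since two nonzero polynomials have a common point
  at which neither vanishes (\<open>common_nonzero_value\<close>), the invariant is that multiple of \<open>\<D>\<close>.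

  Degrees not divisible by six are excluded by scalars: \<open>-1\<close> has determinant one on \<open>\<complex>\<^sup>2\<close> and a
  primitive cube root of unity has determinant one on \<open>\<complex>\<^sup>3\<close>. The number of terms and the coefficients
  are read off the expansion of \<open>det N\<close> into monomials.
\<close>

section \<open>Values of polynomials\<close>

definition eval :: "('v::finite \<Rightarrow> complex) \<Rightarrow> 'v mpoly \<Rightarrow> complex" where
  "eval X f = (\<Sum>m\<in>Poly_Mapping.keys f.
     Poly_Mapping.lookup f m * (\<Prod>v\<in>UNIV. X v ^ Poly_Mapping.lookup m v))"

lemma sum_of_terms:
  "(\<Sum>m\<in>Poly_Mapping.keys f. Poly_Mapping.single m (Poly_Mapping.lookup f m)) = f"
  by (rule poly_mapping_eqI)
    (auto simp: lookup_sum lookup_single when_def in_keys_iff sum.delta)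

lemma eval_superset:
  assumes "finite S" "Poly_Mapping.keys f \<subseteq> S"
  shows "eval X f = (\<Sum>m\<in>S. Poly_Mapping.lookup f m *
    (\<Prod>v\<in>UNIV. X v ^ Poly_Mapping.lookup m v))"
  unfolding eval_def using assms
  by (intro sum.mono_neutral_left) (auto simp: in_keys_iff)

lemma eval_add: "eval X (f + g) = eval X f + eval X g"
proof -
  let ?S = "Poly_Mapping.keys f \<union> Poly_Mapping.keys g"
  have "eval X e = (\<Sum>m\<in>?S. Poly_Mapping.lookup e m *
    (\<Prod>v\<in>UNIV. X v ^ Poly_Mapping.lookup m v))" if "e = f \<or> e = g \<or> e = f + g" for e
    using that keys_add[of f g] by (intro eval_superset) auto
  then show ?thesis
    by (simp add: lookup_add distrib_right sum.distrib)
qed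

lemma eval_zero: "eval X 0 = 0"
  by (simp add: eval_def)

lemma eval_sum: "eval X (sum F S) = (\<Sum>i\<in>S. eval X (F i))"
  by (induction S rule: infinite_finite_induct) (auto simp: eval_add eval_zero)

lemma eval_single:
  "eval X (Poly_Mapping.single m c) = c * (\<Prod>v\<in>UNIV. X v ^ Poly_Mapping.lookup m v)"
  by (cases "c = 0") (auto simp: eval_def)

lemma eval_mult: "eval X (f * g) = eval X f * eval X g"
proof -
  have "f * g = (\<Sum>m\<in>Poly_Mapping.keys f. \<Sum>n\<in>Poly_Mapping.keys g.
      Poly_Mapping.single (m + n) (Poly_Mapping.lookup f m * Poly_Mapping.lookup g n))"
    by (subst (1 2) sum_of_terms[symmetric]) (simp add: sum_product mult_single)
  then show ?thesis
    by (simp add: eval_sum eval_single lookup_add power_add prod.distrib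
        sum_product eval_def[of X f] eval_def[of X g] mult_ac)
qed

lemma eval_Const: "eval X (Const c) = c"
  by (simp add: Const_def eval_single)

lemma prod_power_lookup_single:
  fixes X :: "'v::finite \<Rightarrow> 'a::comm_monoid_mult"
  shows "(\<Prod>w\<in>UNIV. X w ^ Poly_Mapping.lookup (Poly_Mapping.single v n) w) = X v ^ n"
proof -
  have "(\<Prod>w\<in>UNIV. X w ^ Poly_Mapping.lookup (Poly_Mapping.single v n) w)
    = (\<Prod>w\<in>UNIV. if w = v then X w ^ n else 1)"
    by (intro prod.cong) (auto simp: lookup_single when_def)
  then show ?thesis by simp
qed

lemma eval_Var: "eval X (Var v) = X v"
  by (simp add: Var_def eval_single prod_power_lookup_single del: One_nat_def)

lemma eval_one: "eval X 1 = 1"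
  using eval_Const[of X 1] by (simp add: Const_def)

lemma eval_diff: "eval X (f - g) = eval X f - eval X g"
  using eval_add[of X "f - g" g] by simp

lemma eval_power: "eval X (f ^ n) = eval X f ^ n"
  by (induction n) (auto simp: eval_one eval_mult)

lemma eval_prod: "eval X (prod F S) = (\<Prod>i\<in>S. eval X (F i))"
  by (induction S rule: infinite_finite_induct) (auto simp: eval_mult eval_one)

lemma eval_alg_hom:
  fixes \<sigma> :: "'v::finite \<Rightarrow> 'w::finite mpoly"
  shows "eval X (alg_hom \<sigma> f) = eval (\<lambda>v. eval X (\<sigma> v)) f"
proof -
  have "(\<Prod>v\<in>Poly_Mapping.keys m. Y v ^ Poly_Mapping.lookup m v)
    = (\<Prod>v\<in>UNIV. Y v ^ Poly_Mapping.lookup m v)" for Y :: "'v \<Rightarrow> complex" and m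
    by (rule prod.mono_neutral_left) (auto simp: in_keys_iff)
  then show ?thesis
    by (simp add: alg_hom_def eval_def[of _ f] eval_sum eval_mult eval_prod eval_power eval_Const)
qed

lemma sum_keys_eq_sum_UNIV:
  "(\<Sum>v\<in>Poly_Mapping.keys m. Poly_Mapping.lookup m v) = (\<Sum>v\<in>UNIV. Poly_Mapping.lookup m (v :: 'v::finite))"
  by (rule sum.mono_neutral_left) (auto simp: in_keys_iff)

lemma eval_scale:
  assumes "homogeneous n f"
  shows "eval (\<lambda>v. s * X v) f = s ^ n * eval X f"
proof -
  have "(\<Prod>v\<in>UNIV. (s * X v) ^ Poly_Mapping.lookup m v)
    = s ^ n * (\<Prod>v\<in>UNIV. X v ^ Poly_Mapping.lookup m v)" if "m \<in> Poly_Mapping.keys f" for m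
    using assms that
    by (auto simp: homogeneous_def sum_keys_eq_sum_UNIV power_mult_distrib prod.distrib
        simp flip: power_sum)
  then show ?thesis
    by (simp add: eval_def sum_distrib_left mult_ac)
qed

lemma digits_unique:
  fixes N :: nat
  assumes "(\<Sum>i<n. a i * N ^ i) = (\<Sum>i<n. b i * N ^ i)"
    and "\<And>i. a i < N" "\<And>i. b i < N"
  shows "i < n \<Longrightarrow> a i = b i"
  using assms
proof (induction n arbitrary: a b i)
  case (Suc n)
  have shift: "(\<Sum>i<Suc n. c i * N ^ i) = c 0 + N * (\<Sum>i<n. c (Suc i) * N ^ i)" for c
    by (simp add: sum.lessThan_Suc_shift sum_distrib_left mult_ac del: sum.lessThan_Suc)
  have eq: "a 0 + N * (\<Sum>i<n. a (Suc i) * N ^ i) = b 0 + N * (\<Sum>i<n. b (Suc i) * N ^ i)"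
    using Suc.prems(2) by (simp only: shift)
  have "N > 0" using Suc.prems(3)[of 0] by simp
  have "a 0 = b 0"
    using arg_cong[OF eq, of "\<lambda>t. t mod N"] Suc.prems(3)[of 0] Suc.prems(4)[of 0] by simp
  moreover have "(\<Sum>i<n. a (Suc i) * N ^ i) = (\<Sum>i<n. b (Suc i) * N ^ i)"
    using eq \<open>a 0 = b 0\<close> \<open>N > 0\<close> by simp
  then have "a (Suc i) = b (Suc i)" if "i < n" for i
    using Suc.IH[of i "\<lambda>i. a (Suc i)" "\<lambda>i. b (Suc i)"] that Suc.prems(3,4) by blast
  ultimately show ?case
    using Suc.prems(1) by (cases i) auto
qed simp

text \<open>
  Kronecker substitution: with \<open>X\<^sub>v = t ^ (N ^ idx v)\<close> for a large base \<open>N\<close>, distinct monomials become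
  distinct powers of \<open>t\<close>, so nonzero polynomials become nonzero univariate ones, whose product has a
  non-root.
\<close>

lemma common_nonzero_value:
  fixes f g :: "'v::finite mpoly"
  assumes "f \<noteq> 0" "g \<noteq> 0"
  obtains X where "eval X f \<noteq> 0" "eval X g \<noteq> 0"
proof -
  let ?K = "Poly_Mapping.keys f \<union> Poly_Mapping.keys g"
  obtain idx :: "'v \<Rightarrow> nat" where idx: "bij_betw idx UNIV {..<CARD('v)}"
    using ex_bij_betw_finite_nat[of "UNIV :: 'v set"] by (auto simp: atLeast0LessThan)
  \<comment> \<open>a base exceeding every exponent, so that an exponent vector is the digit sequence of its weight\<close>
  define N where "N = Suc (Max ((\<lambda>(m, v). Poly_Mapping.lookup m v) ` (?K \<times> UNIV)))"
  have lessN: "Poly_Mapping.lookup m v < N" if "m \<in> ?K" for m v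
    unfolding N_def using that by (auto intro!: Max_ge simp: less_Suc_eq_le image_iff)
  define wt where "wt m = (\<Sum>v\<in>UNIV. Poly_Mapping.lookup m v * N ^ idx v)" for m :: "'v \<Rightarrow>\<^sub>0 nat"
  have wt_digits: "wt m = (\<Sum>i<CARD('v). Poly_Mapping.lookup m (the_inv_into UNIV idx i) * N ^ i)" for m
    unfolding wt_def sum.reindex_bij_betw[OF idx, symmetric]
    using idx by (simp add: bij_betw_def the_inv_into_f_f)
  have inj: "inj_on wt ?K"
  proof (rule inj_onI)
    fix m m' assume m: "m \<in> ?K" "m' \<in> ?K" "wt m = wt m'"
    have "Poly_Mapping.lookup m v = Poly_Mapping.lookup m' v" for v
    proof -
      have "idx v < CARD('v)" using idx by (auto simp: bij_betw_def)
      from digits_unique[OF m(3)[unfolded wt_digits] lessN[OF m(1)] lessN[OF m(2)] this]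
      show ?thesis using idx by (simp add: bij_betw_def the_inv_into_f_f)
    qed
    then show "m = m'" by (intro poly_mapping_eqI)
  qed
  define U where "U e = (\<Sum>m\<in>Poly_Mapping.keys e. monom (Poly_Mapping.lookup e m) (wt m))"
    for e :: "'v mpoly"
  have eval_U: "eval (\<lambda>v. t ^ (N ^ idx v)) e = poly (U e) t" for t e
    by (simp add: eval_def U_def poly_sum poly_monom wt_def power_sum mult.commute
        flip: power_mult)
  have "U e \<noteq> 0" if "e \<noteq> 0" "Poly_Mapping.keys e \<subseteq> ?K" for e
  proof -
    have "Poly_Mapping.keys e \<noteq> {}"
      using that(1) sum_of_terms[of e] by auto
    then obtain m where m: "m \<in> Poly_Mapping.keys e"
      by blast
    have "coeff (U e) (wt m) = (\<Sum>m'\<in>Poly_Mapping.keys e. if m' = m then Poly_Mapping.lookup e m' else 0)"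
      unfolding U_def coeff_sum
      using inj m that(2) by (intro sum.cong) (auto simp: inj_on_def)
    also have "\<dots> \<noteq> 0" using m by (simp add: in_keys_iff)
    finally show ?thesis by auto
  qed
  then have "U f * U g \<noteq> 0" using assms by simp
  then obtain t where "poly (U f * U g) t \<noteq> 0"
    using poly_all_0_iff_0 by blast
  then show ?thesis
    using that[of "\<lambda>v. t ^ (N ^ idx v)"] by (simp add: eval_U)
qed

lemma mpoly_eqI:
  assumes "\<And>X. eval X f = eval X g"
  shows "f = (g :: 'v::finite mpoly)"
proof (rule ccontr)
  assume "f \<noteq> g"
  then obtain X where "eval X (f - g) \<noteq> 0"
    using common_nonzero_value[of "f - g" "f - g"] by auto
  then show False using assms by (simp add: eval_diff)
qed

section \<open>Arrays and their kernel form\<close>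

type_synonym 'a array = "2 \<times> 2 \<times> 3 \<Rightarrow> 'a"

text \<open>
  The three factors of \<^const>\<open>act\<close>, on values instead of indeterminates, with its convention that the
  columns of a matrix are the images of the basis vectors.
\<close>

definition mode1 :: "'a::idom^2^2 \<Rightarrow> 'a array \<Rightarrow> 'a array" where
  "mode1 A X = (\<lambda>(i, j, k). \<Sum>p\<in>UNIV. A $ p $ i * X (p, j, k))"

definition mode2 :: "'a::idom^2^2 \<Rightarrow> 'a array \<Rightarrow> 'a array" where
  "mode2 B X = (\<lambda>(i, j, k). \<Sum>q\<in>UNIV. B $ q $ j * X (i, q, k))"

definition mode3 :: "'a::idom^3^3 \<Rightarrow> 'a array \<Rightarrow> 'a array" where
  "mode3 C X = (\<lambda>(i, j, k). \<Sum>r\<in>UNIV. C $ r $ k * X (i, j, r))"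

definition fibre :: "'a array \<Rightarrow> 2 \<Rightarrow> 2 \<Rightarrow> 'a^3" where
  "fibre X i j = (\<chi> k. X (i, j, k))"

definition minor :: "'a::idom^3 \<Rightarrow> 'a^3 \<Rightarrow> 'a^3 \<Rightarrow> 'a" where
  "minor u v w = det (vector [u, v, w] :: 'a^3^3)"

text \<open>
  The signed maximal minors of the \<open>4 \<times> 3\<close> matrix with rows \<open>X\<^sub>1\<^sub>1, X\<^sub>1\<^sub>2, X\<^sub>2\<^sub>1, X\<^sub>2\<^sub>2\<close>, which span its left
  kernel if it has full rank.
\<close>

definition kernel_form :: "'a::idom array \<Rightarrow> 'a^2^2" where
  "kernel_form X = vector
     [vector [minor (fibre X 1 2) (fibre X 2 1) (fibre X 2 2), - minor (fibre X 1 1) (fibre X 2 1) (fibre X 2 2)],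
      vector [minor (fibre X 1 1) (fibre X 1 2) (fibre X 2 2), - minor (fibre X 1 1) (fibre X 1 2) (fibre X 2 1)]]"

lemma minor_expand:
  "minor u v w = u$1 * v$2 * w$3 + u$2 * v$3 * w$1 + u$3 * v$1 * w$2
     - u$1 * v$3 * w$2 - u$2 * v$1 * w$3 - u$3 * v$2 * w$1"
  by (simp add: minor_def det_3 vector_3)

lemma array_eqI:
  assumes "\<And>k. X (1, 1, k) = Y (1, 1, k)" "\<And>k. X (1, 2, k) = Y (1, 2, k)"
    "\<And>k. X (2, 1, k) = Y (2, 1, k)" "\<And>k. X (2, 2, k) = Y (2, 2, k)"
  shows "X = (Y :: 'a array)"
proof
  fix v :: "2 \<times> 2 \<times> 3"
  obtain i j k where "v = (i, j, k)" by (cases v)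
  then show "X v = Y v" using assms exhaust_2[of i] exhaust_2[of j] by auto
qed

text \<open>
  Cramer's rule: the left-hand side is the Laplace expansion of a \<open>4 \<times> 4\<close> determinant with two equal
  columns.
\<close>

lemma sum_kernel_form_eq_0:
  "(\<Sum>i\<in>UNIV. \<Sum>j\<in>UNIV. kernel_form X $ i $ j * X (i, j, k)) = 0"
proof -
  have "k = 1 \<or> k = 2 \<or> k = 3" by (rule exhaust_3)
  then show ?thesis
    by (elim disjE)
     (simp_all only: sum_2 kernel_form_def vector_2 minor_expand fibre_def vec_lambda_beta,
       simp_all add: algebra_simps)
qed

text \<open>
  A relation \<open>N'\<close> between the vectors of the new array gives the relation \<open>A N'\<close> between the old
  ones, so \<open>N'\<close> is proportional to \<open>(adj A) N\<close>; the factor, quadratic in \<open>A\<close>, turns out to be \<open>det A\<close>.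
\<close>

lemma kernel_form_mode1_1:
  "kernel_form (mode1 A X) $ 1 $ j
     = det A * (A $ 2 $ 2 * kernel_form X $ 1 $ j - A $ 1 $ 2 * kernel_form X $ 2 $ j)" (is ?first)
  and kernel_form_mode1_2:
  "kernel_form (mode1 A X) $ 2 $ j
     = det A * (A $ 1 $ 1 * kernel_form X $ 2 $ j - A $ 2 $ 1 * kernel_form X $ 1 $ j)" (is ?second)
proof -
  show ?first
    by (rule disjE[OF exhaust_2[of j]]; erule ssubst; simp only: sum_2 kernel_form_def vector_2 minor_expand
        fibre_def vec_lambda_beta mode1_def prod.case det_2; algebra)
  show ?second
    by (rule disjE[OF exhaust_2[of j]]; erule ssubst; simp only: sum_2 kernel_form_def vector_2 minor_expand
        fibre_def vec_lambda_beta mode1_def prod.case det_2; algebra)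
qed

lemma kernel_form_mode2_1:
  "kernel_form (mode2 B X) $ i $ 1
     = det B * (B $ 2 $ 2 * kernel_form X $ i $ 1 - B $ 1 $ 2 * kernel_form X $ i $ 2)" (is ?first)
  and kernel_form_mode2_2:
  "kernel_form (mode2 B X) $ i $ 2
     = det B * (B $ 1 $ 1 * kernel_form X $ i $ 2 - B $ 2 $ 1 * kernel_form X $ i $ 1)" (is ?second)
proof -
  show ?first
    by (rule disjE[OF exhaust_2[of i]]; erule ssubst; simp only: sum_2 kernel_form_def vector_2 minor_expand
        fibre_def vec_lambda_beta mode2_def prod.case det_2; algebra)
  show ?second
    by (rule disjE[OF exhaust_2[of i]]; erule ssubst; simp only: sum_2 kernel_form_def vector_2 minor_expand
        fibre_def vec_lambda_beta mode2_def prod.case det_2; algebra)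
qed

lemma minor_mode3:
  "minor (fibre (mode3 C X) i j) (fibre (mode3 C X) i' j') (fibre (mode3 C X) i'' j'')
    = det C * minor (fibre X i j) (fibre X i' j') (fibre X i'' j'')"
proof -
  have "vector [fibre (mode3 C X) i j, fibre (mode3 C X) i' j', fibre (mode3 C X) i'' j'']
    = (vector [fibre X i j, fibre X i' j', fibre X i'' j''] :: 'a^3^3) ** C"
    by (simp add: vec_eq_iff forall_3 vector_3 fibre_def mode3_def matrix_matrix_mult_def mult.commute)
  then show ?thesis
    by (simp add: minor_def det_mul mult.commute)
qed

lemma det_kernel_form_mode1: "det (kernel_form (mode1 A X)) = det A ^ 3 * det (kernel_form X)"
  unfolding det_2[of "kernel_form _"] kernel_form_mode1_1 kernel_form_mode1_2 det_2[of A] by algebra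

lemma det_kernel_form_mode2: "det (kernel_form (mode2 B X)) = det B ^ 3 * det (kernel_form X)"
  unfolding det_2[of "kernel_form _"] kernel_form_mode2_1 kernel_form_mode2_2 det_2[of B] by algebra

lemma det_kernel_form_mode3: "det (kernel_form (mode3 C X)) = det C ^ 2 * det (kernel_form X)"
  by (simp add: det_2 kernel_form_def vector_2 minor_mode3 algebra_simps power2_eq_square)

text \<open>
  The slices \<open>k = 1, 2, 3\<close> are the matrices \<open>E\<^sub>1\<^sub>1 - E\<^sub>2\<^sub>2\<close>, \<open>E\<^sub>1\<^sub>2\<close>, \<open>E\<^sub>2\<^sub>1\<close>, a basis of the traceless
  \<open>2 \<times> 2\<close> matrices.
\<close>

definition normal_array :: "'a::idom array" where
  "normal_array = (\<lambda>(i, j, k).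
     if i = j then (if k = 1 then (if i = 1 then 1 else - 1) else 0)
     else (if k = (if i = 1 then 2 else 3) then 1 else 0))"

text \<open>
  With the kernel form \<open>N\<close> as base change, \<open>\<Sum> N\<^sub>i\<^sub>j X\<^sub>i\<^sub>j = 0\<close> turns into tracelessness of the slices, whose
  coordinates in the basis above form \<open>C\<close>. Up to sign \<open>det C\<close> is an entry of the new kernel form
  \<open>det N (adj N) N\<close>, which is \<open>(det N)\<^sup>2\<close> times the identity.
\<close>

lemma to_normal_array:
  fixes X :: "'a::idom array"
  obtains C where "mode1 (kernel_form X) X = mode3 C normal_array"
    and "det C = - (det (kernel_form X))\<^sup>2"
proof -
  define Y where "Y = mode1 (kernel_form X) X"
  define C where "C = (vector [fibre Y 1 1, fibre Y 1 2, fibre Y 2 1] :: 'a^3^3)"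
  have "Y (1, 1, k) + Y (2, 2, k) = 0" for k
    using sum_kernel_form_eq_0[of X k] by (simp add: Y_def mode1_def sum_2 algebra_simps)
  then have "Y (2, 2, k) = - Y (1, 1, k)" for k
    by (simp add: eq_neg_iff_add_eq_0 add.commute)
  then have "Y = mode3 C normal_array"
    by (intro array_eqI)
      (simp_all add: mode3_def normal_array_def C_def sum_3 vector_3 fibre_def)
  moreover have "det C = - kernel_form Y $ 2 $ 2"
    by (simp add: C_def kernel_form_def minor_def vector_2)
  then have "det C = - (det (kernel_form X))\<^sup>2"
    unfolding Y_def kernel_form_mode1_2 by (simp add: det_2 power2_eq_square mult_ac)
  ultimately show ?thesis using that unfolding Y_def by blast
qed

section \<open>Invariant polynomials\<close>

lemma eval_act:
  "eval X (act A B C f) = eval (mode1 A (mode2 B (mode3 C X))) f"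
proof -
  have "(\<lambda>v. eval X (case v of (i, j, k) \<Rightarrow>
      \<Sum>p\<in>UNIV. \<Sum>q\<in>UNIV. \<Sum>r\<in>UNIV. Const (A $ p $ i * B $ q $ j * C $ r $ k) * x p q r))
    = mode1 A (mode2 B (mode3 C X))"
    by (auto simp: fun_eq_iff mode1_def mode2_def mode3_def x_def eval_sum eval_mult
        eval_Const eval_Var sum_distrib_left mult_ac)
  then show ?thesis
    by (simp add: act_def eval_alg_hom)
qed

lemma mode1_mat: "mode1 (mat s) X = (\<lambda>v. s * X v)"
  and mode2_mat: "mode2 (mat s) X = (\<lambda>v. s * X v)"
  and mode3_mat: "mode3 (mat s) X = (\<lambda>v. s * X v)"
  by (auto simp: fun_eq_iff mode1_def mode2_def mode3_def mat_def if_distrib[of "\<lambda>t. t * _"]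
      cong: if_cong)

lemma invariantD:
  assumes "invariant f"
  shows "A \<in> SL \<Longrightarrow> eval (mode1 A X) f = eval X f"
    and "C \<in> SL \<Longrightarrow> eval (mode3 C X) f = eval X f"
proof -
  show "eval (mode1 A X) f = eval X f" if "A \<in> SL"
    using assms that eval_act[of X A "mat 1" "mat 1" f]
    by (simp add: invariant_def SL_def mode2_mat mode3_mat)
  show "eval (mode3 C X) f = eval X f" if "C \<in> SL"
    using assms that eval_act[of X "mat 1" "mat 1" C f]
    by (simp add: invariant_def SL_def mode1_mat mode2_mat)
qed

text \<open>
  Rescaling \<open>A\<close> to determinant one needs \<open>s\<close> with \<open>s\<^sup>2 = det A\<close>, and degree six turns \<open>s\<close> into
  \<open>s ^ 6 = det A ^ 3\<close>. The same argument with cube roots applies to the third direction.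
\<close>

lemma eval_mode1_GL:
  assumes "invariant f" "homogeneous 6 f" "det A \<noteq> 0"
  shows "eval (mode1 A X) f = det A ^ 3 * eval X f"
proof -
  define s where "s = csqrt (det A)"
  have s: "s\<^sup>2 = det A" "s \<noteq> 0" using assms(3) by (auto simp: s_def)
  define A' where "A' = (\<chi> i j. A $ i $ j / s)"
  have "A' \<in> SL"
    using s assms(3) by (simp add: SL_def A'_def det_2 power2_eq_square field_simps)
  moreover have "mode1 A X = (\<lambda>v. s * mode1 A' X v)"
    using s by (auto simp: fun_eq_iff mode1_def A'_def sum_distrib_left)
  moreover have "s ^ 6 = det A ^ 3" by (simp flip: s(1))
  ultimately show ?thesis
    using assms(1,2) by (simp add: eval_scale invariantD)
qed

lemma eval_mode3_GL:
  assumes "invariant f" "homogeneous 6 f" "det C \<noteq> 0"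
  shows "eval (mode3 C X) f = det C ^ 2 * eval X f"
proof -
  define s where "s = exp (ln (det C) / 3)"
  have s: "s ^ 3 = det C" "s \<noteq> 0"
    using assms(3) by (auto simp: s_def simp flip: exp_of_nat_mult)
  define C' where "C' = (\<chi> i j. C $ i $ j / s)"
  have "det C' = det C / s ^ 3"
    using s(2) by (simp add: C'_def det_3 power3_eq_cube field_simps)
  then have "C' \<in> SL"
    using s assms(3) by (simp add: SL_def)
  moreover have "mode3 C X = (\<lambda>v. s * mode3 C' X v)"
    using s by (auto simp: fun_eq_iff mode3_def C'_def sum_distrib_left)
  moreover have "s ^ 6 = det C ^ 2" by (simp flip: s(1))
  ultimately show ?thesis
    using assms(1,2) by (simp add: eval_scale invariantD)
qed

text \<open>
  The factors for the base changes \<open>N\<close> and \<open>C\<close> of \<open>to_normal_array\<close> are \<open>d ^ 3\<close> and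
  \<open>(- d\<^sup>2)\<^sup>2 = d ^ 4\<close>, where \<open>d = det N\<close>.
\<close>

lemma eval_eq_normal_form:
  assumes "invariant f" "homogeneous 6 f" and nz: "det (kernel_form X) \<noteq> 0"
  shows "eval X f = det (kernel_form X) * eval normal_array f"
proof -
  define d where "d = det (kernel_form X)"
  obtain C where C: "mode1 (kernel_form X) X = mode3 C normal_array" "det C = - d\<^sup>2"
    using to_normal_array[of X] unfolding d_def by blast
  have "d \<noteq> 0" using nz by (simp add: d_def)
  have "d ^ 3 * eval X f = eval (mode1 (kernel_form X) X) f"
    using eval_mode1_GL[OF assms(1,2) nz, of X] by (simp add: d_def)
  also have "\<dots> = d ^ 3 * (d * eval normal_array f)"
    using eval_mode3_GL[OF assms(1,2), of C normal_array] \<open>d \<noteq> 0\<close>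
    by (simp add: C power_numeral_reduce mult_ac)
  finally show ?thesis using \<open>d \<noteq> 0\<close> by (simp add: d_def)
qed

text \<open>
  The scalars \<open>-1\<close> on \<open>\<complex>\<^sup>2\<close> and \<open>w = exp (2 \<pi> i / 3)\<close> on \<open>\<complex>\<^sup>3\<close> have determinant one and multiply a form of
  degree \<open>n\<close> by \<open>(-1) ^ n\<close> and \<open>w ^ n\<close>.
\<close>

lemma six_dvd_degree_invariant:
  assumes "invariant f" "homogeneous n f" "f \<noteq> 0"
  shows "6 dvd n"
proof -
  obtain X where X: "eval X f \<noteq> 0" using common_nonzero_value[OF assms(3,3)] by blast
  define w where "w = exp (2 * of_real pi * \<i> / 3)"
  have "mat (- 1) \<in> (SL :: (complex^2^2) set)"
    by (simp add: SL_def det_2 mat_def)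
  from invariantD(1)[OF assms(1) this, of X] have "(- 1) ^ n * eval X f = eval X f"
    using eval_scale[OF assms(2), of "-1" X] by (simp add: mode1_mat)
  then have "even n" using X by (cases "even n") auto
  have "exp (2 * (\<i> * of_real pi)) = (1 :: complex)"
    using exp_two_pi_i by (metis mult.assoc mult.commute)
  then have "w ^ 3 = 1" by (simp add: w_def mult_ac flip: exp_of_nat_mult)
  then have "mat w \<in> (SL :: (complex^3^3) set)"
    by (simp add: SL_def det_3 mat_def power3_eq_cube)
  from invariantD(2)[OF assms(1) this, of X] have "w ^ n * eval X f = eval X f"
    using eval_scale[OF assms(2), of w X] by (simp add: mode3_mat)
  then have "w ^ n = 1" using X by simp
  then have "3 dvd n"
    using complex_root_unity_eq_1[of 3 n] by (simp add: w_def mult_ac flip: exp_of_nat_mult)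
  with \<open>even n\<close> show ?thesis by presburger
qed

section \<open>The polynomial as a determinant\<close>

lemma sum_permutations_2:
  "(\<Sum>\<mu> | \<mu> permutes (UNIV :: 2 set). F \<mu>) = F id + F (Transposition.transpose 1 2)"
proof -
  have "(1::2) \<notin> {2}" "finite {2::2}" by auto
  then show ?thesis
    unfolding UNIV_2 by (subst sum_over_permutations_insert) (auto simp: permutes_sing)
qed

lemma sum_permutations_3:
  "(\<Sum>\<pi> | \<pi> permutes (UNIV :: 3 set). F \<pi>) = F id + F (Transposition.transpose 2 3)
     + F (Transposition.transpose 1 2) + F (Transposition.transpose 1 2 \<circ> Transposition.transpose 2 3)
     + F (Transposition.transpose 1 3) + F (Transposition.transpose 1 3 \<circ> Transposition.transpose 2 3)"
proof -
  have *: "finite {2::3, 3}" "(1::3) \<notin> {2, 3}" "finite {3::3}" "(2::3) \<notin> {3}" by auto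
  show ?thesis
    unfolding UNIV_3
    by (simp add: sum_over_permutations_insert[OF *(1,2)] sum_over_permutations_insert[OF *(3,4)]
      permutes_sing add_ac)
qed

lemma eval_perm_act:
  "eval X (perm_act \<mu> \<nu> \<pi> M) = eval (\<lambda>(i, j, k). X (\<mu> i, \<nu> j, \<pi> k)) M"
proof -
  have "(\<lambda>v. eval X (case v of (i, j, k) \<Rightarrow> x (\<mu> i) (\<nu> j) (\<pi> k)))
    = (\<lambda>(i, j, k). X (\<mu> i, \<nu> j, \<pi> k))"
    by (auto simp: x_def eval_Var)
  then show ?thesis
    by (simp add: perm_act_def eval_alg_hom)
qed

lemma eval_orbit:
  "eval X (orbit M) = (\<Sum>\<mu> | \<mu> permutes UNIV. \<Sum>\<nu> | \<nu> permutes UNIV. \<Sum>\<pi> | \<pi> permutes UNIV.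
     of_int (sign \<mu> * sign \<nu>) * eval (\<lambda>(i, j, k). X (\<mu> i, \<nu> j, \<pi> k)) M)"
proof -
  have "eval X (of_int k) = of_int k" for k
    using eval_Const[of X "of_int k"] by (simp add: Const_def)
  then show ?thesis
    by (simp add: orbit_def eval_sum eval_mult eval_perm_act)
qed

text \<open>
  Both sides are expanded in the twelve entries of \<open>X\<close>; doubling clears the coefficients \<open>1/2\<close> in
  front of the orbits.
\<close>

lemma eval_\<D>: "eval X \<D> = det (kernel_form X)"
proof -
  have "2 * eval X \<D> = eval X (orbit ((x 1 1 1)^2 * x 1 2 2 * x 2 1 2 * (x 2 2 3)^2))
     - 2 * eval X (orbit ((x 1 1 1)^2 * x 1 2 2 * x 2 2 2 * x 2 1 3 * x 2 2 3))
     + eval X (orbit (x 1 1 1 * x 1 2 1 * x 1 1 2 * x 2 2 2 * x 2 1 3 * x 2 2 3))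
     + eval X (orbit (x 1 1 1 * x 2 1 1 * x 1 1 2 * x 2 2 2 * x 1 2 3 * x 2 2 3))
     - eval X (orbit (x 1 1 1 * x 2 2 1 * x 1 1 2 * x 2 2 2 * x 1 2 3 * x 2 1 3))"
    by (simp add: \<D>_def eval_add eval_diff eval_mult[of X "Const _"] eval_Const)
  also have "\<dots> = 2 * det (kernel_form X)"
    unfolding eval_orbit sum_permutations_2 sum_permutations_3 x_def eval_mult eval_power
      eval_Var prod.case det_2 kernel_form_def vector_2 minor_expand fibre_def vec_lambda_beta
    by (simp add: sign_id sign_swap_id Transposition.transpose_def, algebra)
  finally show ?thesis by simp
qed

section \<open>The expansion into monomials\<close>

definition vars :: "(2 \<times> 2 \<times> 3) list" where
  "vars = [(1,1,1), (1,1,2), (1,1,3), (1,2,1), (1,2,2), (1,2,3),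
           (2,1,1), (2,1,2), (2,1,3), (2,2,1), (2,2,2), (2,2,3)]"

definition exponents :: "'v list \<Rightarrow> nat list \<Rightarrow> 'v \<Rightarrow>\<^sub>0 nat" where
  "exponents vs e = sum_list (map2 Poly_Mapping.single vs e)"

lemma lookup_exponents_notin:
  "v \<notin> set vs \<Longrightarrow> Poly_Mapping.lookup (exponents vs e) v = 0"
  unfolding exponents_def
  by (induction vs e rule: list_induct2') (auto simp: lookup_add lookup_single when_def)

lemma map_lookup_exponents:
  "distinct vs \<Longrightarrow> length e = length vs \<Longrightarrow> map (Poly_Mapping.lookup (exponents vs e)) vs = e"
proof (induction vs e rule: list_induct2')
  case (4 v vs n e)
  have "map (Poly_Mapping.lookup (exponents (v # vs) (n # e))) vs
    = map (Poly_Mapping.lookup (exponents vs e)) vs"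
    using 4(2) by (auto simp: exponents_def lookup_add lookup_single when_def)
  moreover have "Poly_Mapping.lookup (exponents (v # vs) (n # e)) v = n"
    using 4(2) lookup_exponents_notin[of v vs e] by (simp add: exponents_def lookup_add)
  ultimately show ?case using 4 by (simp del: map_eq_conv)
qed simp_all

lemma eval_exponents:
  "eval X (Poly_Mapping.single (exponents vs e) c) = c * prod_list (map2 (\<lambda>v n. X v ^ n) vs e)"
proof -
  have "(\<Prod>v\<in>UNIV. X v ^ Poly_Mapping.lookup (exponents vs e) v) = prod_list (map2 (\<lambda>v n. X v ^ n) vs e)"
    unfolding exponents_def
    by (induction vs e rule: list_induct2') (simp_all add: lookup_add power_add prod.distrib prod_power_lookup_single)
  then show ?thesis by (simp add: eval_single)
qed

lemma sum_lookup_exponents: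
  "length e = length vs \<Longrightarrow> (\<Sum>v\<in>UNIV. Poly_Mapping.lookup (exponents vs e) (v::'v::finite)) = sum_list e"
  unfolding exponents_def
  by (induction vs e rule: list_induct2')
     (simp_all add: lookup_add sum.distrib lookup_single when_def)

lemma keys_sum_list_single:
  assumes "distinct (map fst T)" "inj_on g (set (map fst T))" "\<forall>(e, c)\<in>set T. c \<noteq> 0"
  defines "p \<equiv> (\<Sum>(e, c)\<leftarrow>T. Poly_Mapping.single (g e) c)"
  shows "Poly_Mapping.keys p = g ` set (map fst T)"
    and "(e, c) \<in> set T \<Longrightarrow> Poly_Mapping.lookup p (g e) = c"
proof -
  have outside: "Poly_Mapping.lookup (\<Sum>(e, c)\<leftarrow>T. Poly_Mapping.single (g e) c) m = 0"
    if "m \<notin> g ` set (map fst T)" for m and T :: "('a \<times> 'b) list"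
    using that by (induction T) (auto simp: lookup_add lookup_single when_def)
  have inside: "Poly_Mapping.lookup (\<Sum>(e, c)\<leftarrow>T. Poly_Mapping.single (g e) c) (g e) = c"
    if "distinct (map fst T)" "inj_on g (set (map fst T))" "(e, c) \<in> set T" for e c
      and T :: "('a \<times> 'b) list"
    using that
  proof (induction T)
    case (Cons t T)
    obtain a b where t: "t = (a, b)" by (cases t)
    show ?case
    proof (cases "(e, c) = t")
      case True
      then have "g e \<notin> g ` set (map fst T)"
        using Cons.prems(1,2) by (auto simp: inj_on_def)
      then show ?thesis using True t outside[of "g e" T] by (simp add: lookup_add)
    next
      case False
      then have "(e, c) \<in> set T" using Cons.prems(3) by auto
      then have "g a \<noteq> g e" using Cons.prems(1,2) t by (force simp: inj_on_def)
      then show ?thesis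
        using Cons \<open>(e, c) \<in> set T\<close> t by (simp add: lookup_add lookup_single when_def)
    qed
  qed simp
  show "(e, c) \<in> set T \<Longrightarrow> Poly_Mapping.lookup p (g e) = c"
    using inside assms by blast
  show "Poly_Mapping.keys p = g ` set (map fst T)"
  proof (intro equalityI subsetI)
    fix m assume "m \<in> Poly_Mapping.keys p"
    then show "m \<in> g ` set (map fst T)"
      using outside[of m T] by (auto simp: p_def in_keys_iff)
  next
    fix m assume "m \<in> g ` set (map fst T)"
    then obtain e c where "(e, c) \<in> set T" "m = g e" by auto
    then show "m \<in> Poly_Mapping.keys p"
      using inside assms by (auto simp: in_keys_iff)
  qed
qed

text \<open>
  The expansion of \<open>det N\<close>: exponent vectors, in the order of \<open>vars\<close>, with their coefficients.
\<close>

definition term_list :: "(nat list \<times> complex) list" where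
  "term_list = [
    ([2,0,0,0,1,0,0,1,0,0,0,2], 1), ([2,0,0,0,1,0,0,0,1,0,1,1], -1),
    ([2,0,0,0,0,1,0,1,0,0,1,1], -1), ([2,0,0,0,0,1,0,0,1,0,2,0], 1),
    ([1,1,0,1,0,0,0,1,0,0,0,2], -1), ([1,1,0,1,0,0,0,0,1,0,1,1], 1),
    ([1,1,0,0,1,0,1,0,0,0,0,2], -1), ([1,1,0,0,1,0,0,0,1,1,0,1], 1),
    ([1,1,0,0,0,1,1,0,0,0,1,1], 1), ([1,1,0,0,0,1,0,1,0,1,0,1], 1),
    ([1,1,0,0,0,1,0,0,1,1,1,0], -2), ([1,0,1,1,0,0,0,1,0,0,1,1], 1),
    ([1,0,1,1,0,0,0,0,1,0,2,0], -1), ([1,0,1,0,1,0,1,0,0,0,1,1], 1),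
    ([1,0,1,0,1,0,0,1,0,1,0,1], -2), ([1,0,1,0,1,0,0,0,1,1,1,0], 1),
    ([1,0,1,0,0,1,1,0,0,0,2,0], -1), ([1,0,1,0,0,1,0,1,0,1,1,0], 1),
    ([1,0,0,1,1,0,0,1,1,0,0,1], -1), ([1,0,0,1,1,0,0,0,2,0,1,0], 1),
    ([1,0,0,1,0,1,0,2,0,0,0,1], 1), ([1,0,0,1,0,1,0,1,1,0,1,0], -1),
    ([1,0,0,0,2,0,1,0,1,0,0,1], 1), ([1,0,0,0,2,0,0,0,2,1,0,0], -1),
    ([1,0,0,0,1,1,1,1,0,0,0,1], -1), ([1,0,0,0,1,1,1,0,1,0,1,0], -1),
    ([1,0,0,0,1,1,0,1,1,1,0,0], 2), ([1,0,0,0,0,2,1,1,0,0,1,0], 1),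
    ([1,0,0,0,0,2,0,2,0,1,0,0], -1), ([0,2,0,1,0,0,1,0,0,0,0,2], 1),
    ([0,2,0,1,0,0,0,0,1,1,0,1], -1), ([0,2,0,0,0,1,1,0,0,1,0,1], -1),
    ([0,2,0,0,0,1,0,0,1,2,0,0], 1), ([0,1,1,1,0,0,1,0,0,0,1,1], -2),
    ([0,1,1,1,0,0,0,1,0,1,0,1], 1), ([0,1,1,1,0,0,0,0,1,1,1,0], 1),
    ([0,1,1,0,1,0,1,0,0,1,0,1], 1), ([0,1,1,0,1,0,0,0,1,2,0,0], -1),
    ([0,1,1,0,0,1,1,0,0,1,1,0], 1), ([0,1,1,0,0,1,0,1,0,2,0,0], -1),
    ([0,1,0,2,0,0,0,1,1,0,0,1], 1), ([0,1,0,2,0,0,0,0,2,0,1,0], -1),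
    ([0,1,0,1,1,0,1,0,1,0,0,1], -1), ([0,1,0,1,1,0,0,0,2,1,0,0], 1),
    ([0,1,0,1,0,1,1,1,0,0,0,1], -1), ([0,1,0,1,0,1,1,0,1,0,1,0], 2),
    ([0,1,0,1,0,1,0,1,1,1,0,0], -1), ([0,1,0,0,1,1,2,0,0,0,0,1], 1),
    ([0,1,0,0,1,1,1,0,1,1,0,0], -1), ([0,1,0,0,0,2,2,0,0,0,1,0], -1),
    ([0,1,0,0,0,2,1,1,0,1,0,0], 1), ([0,0,2,1,0,0,1,0,0,0,2,0], 1),
    ([0,0,2,1,0,0,0,1,0,1,1,0], -1), ([0,0,2,0,1,0,1,0,0,1,1,0], -1),
    ([0,0,2,0,1,0,0,1,0,2,0,0], 1), ([0,0,1,2,0,0,0,2,0,0,0,1], -1),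
    ([0,0,1,2,0,0,0,1,1,0,1,0], 1), ([0,0,1,1,1,0,1,1,0,0,0,1], 2),
    ([0,0,1,1,1,0,1,0,1,0,1,0], -1), ([0,0,1,1,1,0,0,1,1,1,0,0], -1),
    ([0,0,1,1,0,1,1,1,0,0,1,0], -1), ([0,0,1,1,0,1,0,2,0,1,0,0], 1),
    ([0,0,1,0,2,0,2,0,0,0,0,1], -1), ([0,0,1,0,2,0,1,0,1,1,0,0], 1),
    ([0,0,1,0,1,1,2,0,0,0,1,0], 1), ([0,0,1,0,1,1,1,1,0,1,0,0], -1)
  ]"

lemma term_list_wf:
  "distinct (map fst term_list)" "length term_list = 66"
  "\<forall>(e, c)\<in>set term_list. length e = length vars \<and> sum_list e = 6 \<and> c \<in> {1, -1, 2, -2}"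
  unfolding term_list_def vars_def by simp_all

lemma \<D>_eq_sum_term_list: "\<D> = (\<Sum>(e, c)\<leftarrow>term_list. Poly_Mapping.single (exponents vars e) c)"
proof (rule mpoly_eqI)
  fix X
  have "det (kernel_form X) = (\<Sum>(e, c)\<leftarrow>term_list. c * prod_list (map2 (\<lambda>v n. X v ^ n) vars e))"
    by (simp add: term_list_def vars_def det_2 kernel_form_def vector_2 minor_expand fibre_def, algebra)
  moreover have "eval X (\<Sum>(e, c)\<leftarrow>T. Poly_Mapping.single (exponents vars e) c) 
    = (\<Sum>(e, c)\<leftarrow>T. c * prod_list (map2 (\<lambda>v n. X v ^ n) vars e))" for T
    by (induction T) (auto simp: eval_zero eval_add eval_exponents)
  ultimately show "eval X \<D> = eval X (\<Sum>(e, c)\<leftarrow>term_list. Poly_Mapping.single (exponents vars e) c)"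
    by (simp add: eval_\<D>)
qed

lemma inj_on_exponents: "inj_on (exponents vars) (set (map fst term_list))"
proof (rule inj_on_inverseI)
  fix e assume "e \<in> set (map fst term_list)"
  then have "length e = length vars" using term_list_wf(3) by auto
  moreover have "distinct vars" by (simp add: vars_def)
  ultimately show "map (Poly_Mapping.lookup (exponents vars e)) vars = e"
    by (intro map_lookup_exponents)
qed

lemma term_list_nonzero: "\<forall>(e, c)\<in>set term_list. c \<noteq> 0"
  using term_list_wf(3) by auto

lemmas keys_\<D> = keys_sum_list_single(1)[OF term_list_wf(1) inj_on_exponents term_list_nonzero,
    folded \<D>_eq_sum_term_list]

lemmas lookup_\<D> = keys_sum_list_single(2)[OF term_list_wf(1) inj_on_exponents term_list_nonzero,
    folded \<D>_eq_sum_term_list]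

lemma card_keys_\<D>: "card (Poly_Mapping.keys \<D>) = 66"
  using distinct_card[OF term_list_wf(1)] term_list_wf(2)
  by (simp only: keys_\<D> card_image[OF inj_on_exponents] length_map)

lemma lookup_\<D>_cases:
  assumes "m \<in> Poly_Mapping.keys \<D>"
  shows "Poly_Mapping.lookup \<D> m \<in> {1, -1, 2, -2}"
proof -
  obtain e c where "(e, c) \<in> set term_list" "m = exponents vars e"
    using assms unfolding keys_\<D> by auto
  then show ?thesis using lookup_\<D> term_list_wf(3) by auto
qed

lemma homogeneous_\<D>: "homogeneous 6 \<D>"
  unfolding homogeneous_def
proof
  fix m assume "m \<in> Poly_Mapping.keys \<D>"
  then obtain e c where "(e, c) \<in> set term_list" "m = exponents vars e"
    unfolding keys_\<D> by auto
  moreover from this have "length e = length vars" "sum_list e = 6"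
    using term_list_wf(3) by auto
  ultimately show "(\<Sum>v\<in>Poly_Mapping.keys m. Poly_Mapping.lookup m v) = 6"
    by (simp add: sum_keys_eq_sum_UNIV sum_lookup_exponents)
qed

section \<open>The simplest invariant\<close>

theorem mainTheorem1:
  shows "(\<forall>n. 1 \<le> n \<and> n \<le> 5 \<longrightarrow> \<not> (\<exists>f. f \<noteq> 0 \<and> homogeneous n f \<and> invariant f)) \<and>
    \<D> \<noteq> 0 \<and> homogeneous 6 \<D> \<and> invariant \<D> \<and>
    (\<forall>f. homogeneous 6 f \<and> invariant f \<longrightarrow> (\<exists>c. f = Const c * \<D>)) \<and>
    card (Poly_Mapping.keys \<D>) = 66 \<and>
    (\<forall>m\<in>Poly_Mapping.keys \<D>. Poly_Mapping.lookup \<D> m \<in> {1, -1, 2, -2})"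
proof -
  have "\<D> \<noteq> 0" using card_keys_\<D> by auto
  have "invariant \<D>"
    unfolding invariant_def
  proof (intro ballI mpoly_eqI)
    fix A B :: "complex^2^2" and C :: "complex^3^3" and X
    assume "A \<in> SL" "B \<in> SL" "C \<in> SL"
    then show "eval X (act A B C \<D>) = eval X \<D>"
      by (simp add: eval_act eval_\<D> det_kernel_form_mode1 det_kernel_form_mode2
          det_kernel_form_mode3 SL_def)
  qed
  have "f = Const (eval normal_array f) * \<D>" if f: "homogeneous 6 f" "invariant f" for f
  proof (rule ccontr)
    assume "f \<noteq> Const (eval normal_array f) * \<D>"
    then obtain X where X: "eval X (f - Const (eval normal_array f) * \<D>) \<noteq> 0" "eval X \<D> \<noteq> 0"
      using common_nonzero_value[of "f - Const (eval normal_array f) * \<D>" \<D>] \<open>\<D> \<noteq> 0\<close> by auto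
    then have val: "eval X f = det (kernel_form X) * eval normal_array f"
      using eval_eq_normal_form[OF f(2,1), of X] by (simp add: eval_\<D>)
    then show False
      using X(1) by (simp add: val eval_diff eval_mult eval_Const eval_\<D> mult.commute)
  qed
  moreover have "\<not> (\<exists>f. f \<noteq> 0 \<and> homogeneous n f \<and> invariant f)" if "1 \<le> n \<and> n \<le> 5" for n
  proof -
    have "\<not> 6 dvd n" using that by (auto dest: dvd_imp_le)
    then show ?thesis using six_dvd_degree_invariant by blast
  qed
  ultimately show ?thesis
    using card_keys_\<D> lookup_\<D>_cases \<open>\<D> \<noteq> 0\<close> homogeneous_\<D> \<open>invariant \<D>\<close> by blast
qed

end
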